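(* For any points $X_1,\dots,X_n\in\Omega\subset\mathbb{R}^d$ and any $m\in\mathbb{N}$, $$\mathrm{pdim}\big(F(\underline X^n;\mathcal{P}_m)\big)\le6md\log(3m).$$
   Context: $\Omega\subset\mathbb{R}^d$ is a convex body and $\mathcal{P}_m$ is the class of functions on $\Omega$ of the form $f(x)=\max_{1\le i\le m}(a_i^Tx+b_i)$ with $a_i\in\mathbb{R}^d$, $b_i\in\mathbb{R}$. $F(\underline X^n;\mathcal{P}_m):=\{(g(X_1),\dots,g(X_n)):g\in\mathcal{P}_m\}\subset\mathbb{R}^n$. A set $V\subset\mathbb{R}^n$ has pseudo-dimension at most $t$ ($t$ a nonnegative integer) if for every set $I\subset\{1,\dots,n\}$ of $t+1$ distinct indices and every $x\in\mathbb{R}^I$ there is $J\subset I$ such that no $v\in V$ satisfies both $v_i>x_i$ for all $i\in J$ and $v_i<x_i$ for all $i\in I\setminus J$; $\mathrm{pdim}(V)$ is the smallest such $t$. $\log$ is the natural logarithm. *)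

theory Defs
  imports "HOL-Analysis.Analysis"
begin

definition convex_body :: "(real ^ 'd) set \<Rightarrow> bool" where
  "convex_body \<Omega> \<longleftrightarrow> convex \<Omega> \<and> compact \<Omega> \<and> interior \<Omega> \<noteq> {}"

text \<open>Functions on \<open>\<Omega>\<close> are functions on the whole space, restricted to \<open>\<Omega>\<close>
  (with the value \<open>undefined\<close> elsewhere). The pieces need not be distinct. Only \<open>m \<ge> 1\<close> is
  meaningful, since \<open>Max {}\<close> is unspecified.\<close>

definition max_affine :: "(real ^ 'd) set \<Rightarrow> nat \<Rightarrow> (real ^ 'd \<Rightarrow> real) set" where
  "max_affine \<Omega> m =
     {restrict (\<lambda>x. MAX i\<in>{1..m}. a i \<bullet> x + b i) \<Omega> |
        (a :: nat \<Rightarrow> real ^ 'd) (b :: nat \<Rightarrow> real). True}"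

definition sample_values ::
  "('n \<Rightarrow> real ^ 'd) \<Rightarrow> (real ^ 'd \<Rightarrow> real) set \<Rightarrow> (real ^ 'n) set" where
  "sample_values X G = {\<chi> i. g (X i) | g. g \<in> G}"

text \<open>The level vector \<open>x\<close>, an element of \<open>\<real>\<^sup>I\<close>, is represented by a function on all indices;
  only its values on \<open>I\<close> matter.\<close>

definition pdim_at_most :: "(real ^ 'n) set \<Rightarrow> nat \<Rightarrow> bool" where
  "pdim_at_most V t \<longleftrightarrow>
     (\<forall>(I :: 'n set) (x :: 'n \<Rightarrow> real). card I = t + 1 \<longrightarrow>
        (\<exists>J\<subseteq>I. \<not> (\<exists>v\<in>V. (\<forall>i\<in>J. v $ i > x i) \<and> (\<forall>i\<in>I - J. v $ i < x i))))"

definition pdim :: "(real ^ 'n) set \<Rightarrow> nat" where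
  "pdim V = (LEAST t. pdim_at_most V t)"

text \<open>The minimum in \<open>pdim\<close> is attained: \<open>n\<close> is always an admissible value in dimension \<open>n\<close>.\<close>

lemma pdim_at_most_CARD: "pdim_at_most (V :: (real ^ 'n) set) CARD('n)"
proof -
  have "card I \<noteq> CARD('n) + 1" for I :: "'n set"
    using card_mono[of "UNIV :: 'n set" I] by simp
  then show ?thesis by (simp add: pdim_at_most_def)
qed

lemma pdim_at_most_pdim: "pdim_at_most V (pdim V)"
  unfolding pdim_def by (rule LeastI, rule pdim_at_most_CARD)

end

theory Submission
  imports Defs
begin

text \<open>If a set \<open>I\<close> of \<open>t\<close> indices is pseudo-shattered with levels \<open>x\<close>, then every subset of \<open>I\<close> is
  an intersection of \<open>m\<close> sets of the form \<open>{i \<in> I. a \<bullet> X i + b < x i}\<close>. An affine dependence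
  among \<open>d + 2\<close> of the points \<open>X i\<close> shows that these sets shatter no index set of size \<open>d + 2\<close>,
  so by the Sauer--Shelah lemma there are at most \<open>(e t / (d + 1)) ^ (d + 1)\<close> of them. Hence
  \<open>2 ^ t \<le> (e t / (d + 1)) ^ (m (d + 1))\<close>, which bounds \<open>t\<close>.\<close>

section \<open>Shattering and the Sauer--Shelah lemma\<close>

definition shatters :: "'a set set \<Rightarrow> 'a set \<Rightarrow> bool" where
  "shatters F S \<longleftrightarrow> (\<forall>J\<subseteq>S. \<exists>A\<in>F. A \<inter> S = J)"

lemma shattersD: "shatters F S \<Longrightarrow> J \<subseteq> S \<Longrightarrow> \<exists>A\<in>F. A \<inter> S = J"
  by (simp add: shatters_def)

text \<open>Pajor's form of the Sauer--Shelah lemma, by induction on the ground set. Deleting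
  \<open>y\<close> merges members of \<open>F\<close> that differ only in \<open>y\<close>:
  \<open>F0\<close> is the family after merging, \<open>F1\<close> records the merged pairs. Sets
  shattered by \<open>F0\<close> are shattered by \<open>F\<close>, and those shattered by
  \<open>F1\<close> remain shattered by \<open>F\<close> with \<open>y\<close> added.\<close>

lemma card_le_card_shattered:
  assumes "finite I" "F \<subseteq> Pow I"
  shows "card F \<le> card {S. S \<subseteq> I \<and> shatters F S}"
  using assms
proof (induction I arbitrary: F rule: finite_induct)
  case empty
  show ?case
  proof (cases "F = {}")
    case False
    then have F: "F = {{}}" using empty by auto
    have "{S. S \<subseteq> {} \<and> shatters F S} = {{}}"
      by (auto simp: F shatters_def)
    then show ?thesis by (simp only: F)
  qed simp
next
  case (insert y I)
  define F0 where "F0 = (\<lambda>A. A - {y}) ` F"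
  define F1 where "F1 = {A. A \<subseteq> I \<and> A \<in> F \<and> insert y A \<in> F}"
  define S0 where "S0 = {S. S \<subseteq> I \<and> shatters F0 S}"
  define S1 where "S1 = {S. S \<subseteq> I \<and> shatters F1 S}"
  have finI: "finite (Pow I)" using insert.hyps by simp
  have finF: "finite F" using finite_subset[OF insert.prems] insert.hyps(1) by simp
  have F0I: "F0 \<subseteq> Pow I" and F1I: "F1 \<subseteq> Pow I"
    using insert.prems by (auto simp: F0_def F1_def)
  \<comment> \<open>Splitting \<open>F\<close> by membership of \<open>y\<close> turns
    \<open>F0\<close> into a union and \<open>F1\<close> into an intersection, so
    \<open>card_Un_Int\<close> counts both at once.\<close>
  define P where "P = {A \<in> F. y \<notin> A}"
  define Q where "Q = (\<lambda>A. A - {y}) ` {A \<in> F. y \<in> A}"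
  have injQ: "inj_on (\<lambda>A. A - {y}) {A \<in> F. y \<in> A}"
    by (auto simp: inj_on_def)
  have F: "P \<union> {A \<in> F. y \<in> A} = F" by (auto simp: P_def)
  have "(\<lambda>A. A - {y}) ` P = id ` P" by (rule image_cong) (auto simp: P_def)
  then have "F0 = P \<union> Q"
    unfolding F0_def Q_def by (subst F[symmetric]) (simp only: image_Un image_id id_apply)
  moreover have "F1 = P \<inter> Q"
  proof (intro set_eqI iffI)
    fix A assume A: "A \<in> F1"
    then have "y \<notin> A" using insert.hyps by (auto simp: F1_def)
    then have "A = insert y A - {y}" by simp
    then show "A \<in> P \<inter> Q" using A \<open>y \<notin> A\<close> by (auto simp: F1_def P_def Q_def)
  next
    fix A assume "A \<in> P \<inter> Q"
    then show "A \<in> F1" using insert.prems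
      by (auto simp: F1_def P_def Q_def insert_absorb)
  qed
  moreover have "finite P" "finite Q" using finF by (auto simp: P_def Q_def)
  ultimately have "card F0 + card F1 = card P + card Q"
    using card_Un_Int[of P Q] by (simp only:)
  also have "card Q = card {A \<in> F. y \<in> A}"
    unfolding Q_def by (rule card_image[OF injQ])
  also have "card P + card {A \<in> F. y \<in> A} = card (P \<union> {A \<in> F. y \<in> A})"
    using finF by (subst card_Un_disjoint) (auto simp: P_def)
  finally have split: "card F = card F0 + card F1" by (simp only: F)
  have y_S: "y \<notin> S" if "S \<subseteq> I" for S using that insert.hyps by auto
  have sh0: "shatters F S" if S: "S \<in> S0" for S
    unfolding shatters_def
  proof (intro allI impI)
    fix J assume "J \<subseteq> S"
    then obtain A where A: "A \<in> F" "(A - {y}) \<inter> S = J"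
      using S shattersD[of F0 S J] by (auto simp: S0_def F0_def)
    moreover have "(A - {y}) \<inter> S = A \<inter> S" using S y_S by (auto simp: S0_def)
    ultimately show "\<exists>A\<in>F. A \<inter> S = J" by auto
  qed
  \<comment> \<open>A member \<open>A\<close> of \<open>F1\<close> lies in \<open>F\<close> both
    with and without \<open>y\<close>, so \<open>y\<close> can be included or excluded at
    will.\<close>
  have sh1: "shatters F (insert y S)" if S: "S \<in> S1" for S
    unfolding shatters_def
  proof (intro allI impI)
    fix J assume J: "J \<subseteq> insert y S"
    then have "J - {y} \<subseteq> S" by auto
    then obtain A where A: "A \<in> F1" "A \<inter> S = J - {y}"
      using S shattersD[of F1 S "J - {y}"] by (auto simp: S1_def)
    have "y \<notin> A" "y \<notin> S" using A S y_S by (auto simp: F1_def S1_def)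
    show "\<exists>A\<in>F. A \<inter> insert y S = J"
    proof (cases "y \<in> J")
      case True
      have "insert y A \<in> F" "insert y A \<inter> insert y S = J"
        using A True \<open>y \<notin> S\<close> by (auto simp: F1_def)
      then show ?thesis by blast
    next
      case False
      have "A \<in> F" "A \<inter> insert y S = J"
        using A False \<open>y \<notin> A\<close> by (auto simp: F1_def)
      then show ?thesis by blast
    qed
  qed
  have inj: "inj_on (insert y) S1"
    using y_S by (auto simp: inj_on_def S1_def dest!: insert_ident[THEN iffD1, rotated 2])
  have fin: "finite S0" "finite S1"
    using finI by (auto simp: S0_def S1_def)
  have "card F \<le> card S0 + card S1"
    unfolding split S0_def S1_def using insert.IH[OF F0I] insert.IH[OF F1I] by linarith
  also have "\<dots> = card (S0 \<union> insert y ` S1)"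
    using fin y_S by (subst card_Un_disjoint) (auto simp: card_image[OF inj] S0_def)
  also have "\<dots> \<le> card {S. S \<subseteq> insert y I \<and> shatters F S}"
  proof (rule card_mono)
    show "finite {S. S \<subseteq> insert y I \<and> shatters F S}"
      using insert.hyps by (auto intro: finite_subset[of _ "Pow (insert y I)"])
    show "S0 \<union> insert y ` S1 \<subseteq> {S. S \<subseteq> insert y I \<and> shatters F S}"
      using sh0 sh1 by (auto simp: S0_def S1_def)
  qed
  finally show ?case .
qed

lemma sum_binomial_le:
  assumes "0 < D" "D \<le> t"
  shows "real (\<Sum>j\<le>D. t choose j) \<le> (exp 1 * real t / real D) ^ D"
proof -
  \<comment> \<open>The weight \<open>l\<close> satisfies \<open>l \<le> 1\<close>, so
    \<open>l ^ D \<le> l ^ j\<close> for \<open>j \<le> D\<close>; this choice of \<open>l\<close>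
    also makes \<open>exp l ^ t\<close> equal to \<open>exp 1 ^ D\<close>.\<close>
  define l where "l = real D / real t"
  have l: "0 < l" "l \<le> 1" using assms by (auto simp: l_def)
  have "real (\<Sum>j\<le>D. t choose j) * l ^ D = (\<Sum>j\<le>D. real (t choose j) * l ^ D)"
    by (simp add: sum_distrib_right)
  also have "\<dots> \<le> (\<Sum>j\<le>D. real (t choose j) * l ^ j)"
    using l by (intro sum_mono mult_left_mono power_decreasing) auto
  also have "\<dots> \<le> (\<Sum>j\<le>t. real (t choose j) * l ^ j)"
    using l assms by (intro sum_mono2) auto
  also have "\<dots> = (1 + l) ^ t"
    using binomial_ring[of l 1 t] by (simp add: add.commute)
  also have "\<dots> \<le> exp l ^ t"
    using l by (intro power_mono) auto
  also have "\<dots> = exp 1 ^ D"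
    using assms by (simp add: l_def flip: exp_of_nat_mult)
  finally have "real (\<Sum>j\<le>D. t choose j) \<le> exp 1 ^ D / l ^ D"
    using l by (simp add: pos_le_divide_eq)
  also have "\<dots> = (exp 1 * real t / real D) ^ D"
    by (simp add: l_def power_divide power_mult_distrib)
  finally show ?thesis .
qed

text \<open>Shattering passes to subsets, so excluding size \<open>D + 1\<close> excludes all larger
  sizes, and only sets of size at most \<open>D\<close> remain to be counted.\<close>

lemma Sauer_Shelah:
  assumes "finite I" "F \<subseteq> Pow I" "0 < D" "D \<le> card I"
    and "\<And>S. S \<subseteq> I \<Longrightarrow> card S = D + 1 \<Longrightarrow> \<not> shatters F S"
  shows "real (card F) \<le> (exp 1 * real (card I) / real D) ^ D"
proof -
  have small: "card S \<le> D" if S: "S \<subseteq> I" "shatters F S" for S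
  proof (rule ccontr)
    assume "\<not> card S \<le> D"
    then obtain T where T: "T \<subseteq> S" "card T = D + 1"
      by (metis Suc_eq_plus1 not_less_eq_eq obtain_subset_with_card_n)
    have "shatters F T"
      unfolding shatters_def
    proof (intro allI impI)
      fix J assume J: "J \<subseteq> T"
      then obtain A where "A \<in> F" "A \<inter> S = J" using S T by (meson order_trans shattersD)
      then show "\<exists>A\<in>F. A \<inter> T = J" using T J by blast
    qed
    then show False using assms(5)[of T] T S by auto
  qed
  have "card F \<le> card {S. S \<subseteq> I \<and> shatters F S}"
    by (rule card_le_card_shattered) fact+
  also have "\<dots> \<le> card (\<Union>j\<le>D. {S. S \<subseteq> I \<and> card S = j})"
    using small assms(1) by (intro card_mono) auto
  also have "\<dots> \<le> (\<Sum>j\<le>D. card {S. S \<subseteq> I \<and> card S = j})"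
    by (rule card_UN_le) simp
  also have "\<dots> = (\<Sum>j\<le>D. card I choose j)"
    using assms(1) by (simp add: n_subsets)
  finally have "real (card F) \<le> real (\<Sum>j\<le>D. card I choose j)"
    by (rule of_nat_mono)
  also have "\<dots> \<le> (exp 1 * real (card I) / real D) ^ D"
    by (rule sum_binomial_le) fact+
  finally show ?thesis .
qed

section \<open>Affine functions cut by index-dependent levels\<close>

text \<open>Coefficients are attached to indices because \<open>X\<close> may repeat a point while
  the levels at the repeated indices differ.\<close>

lemma affine_dependent_family:
  fixes X :: "'a \<Rightarrow> 'v::euclidean_space"
  assumes "finite S" "card S \<ge> DIM('v) + 2"
  shows "\<exists>c. (\<Sum>i\<in>S. c i) = 0 \<and> (\<Sum>i\<in>S. c i *\<^sub>R X i) = 0 \<and> (\<exists>i\<in>S. c i \<noteq> 0)"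
proof (cases "inj_on X S")
  case True
  then have "affine_dependent (X ` S)"
    using assms by (intro affine_dependent_biggerset) (auto simp: card_image)
  then obtain u where u: "sum u (X ` S) = 0" "\<exists>v\<in>X ` S. u v \<noteq> 0"
      "(\<Sum>v\<in>X ` S. u v *\<^sub>R v) = 0"
    using assms(1) by (auto simp: affine_dependent_explicit_finite)
  then show ?thesis
    using True by (intro exI[of _ "u \<circ> X"]) (auto simp: sum.reindex)
next
  case False
  then obtain i j where ij: "i \<in> S" "j \<in> S" "i \<noteq> j" "X i = X j"
    by (auto simp: inj_on_def)
  \<comment> \<open>Two indices with the same point get the coefficients 1 and -1.\<close>
  define c where "c = (\<lambda>k. (if k = i then 1 else 0) - (if k = j then 1 else 0 :: real))"
  have "(\<Sum>k\<in>S. c k) = 0"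
    using assms(1) ij by (simp add: c_def sum_subtractf)
  moreover have "(\<Sum>k\<in>S. c k *\<^sub>R X k) = 0"
    using assms(1) ij
    by (simp add: c_def scaleR_left_diff_distrib sum_subtractf if_distrib[of "\<lambda>r. r *\<^sub>R _"] cong: if_cong)
  moreover have "c i \<noteq> 0" using ij by (simp add: c_def)
  ultimately show ?thesis using ij by blast
qed

text \<open>For the lifted points \<open>(X i, x i)\<close> these are the index sets cut out by the
  open half-spaces above non-vertical hyperplanes.\<close>

definition affine_sublevels ::
  "('a \<Rightarrow> 'v::real_inner) \<Rightarrow> ('a \<Rightarrow> real) \<Rightarrow> 'a set \<Rightarrow> 'a set set" where
  "affine_sublevels X x I = {{i \<in> I. a \<bullet> X i + b < x i} | a b. True}"

text \<open>For an affine dependence \<open>c\<close>, the \<open>c\<close>-weighted sum of the gaps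
  \<open>a \<bullet> X i + b - x i\<close> does not depend on \<open>a\<close> and \<open>b\<close>.
  Cutting out the indices with \<open>c i > 0\<close> makes it negative, cutting out those with
  \<open>c i < 0\<close> makes it nonnegative.\<close>

lemma affine_sublevels_not_shatters:
  fixes X :: "'a \<Rightarrow> 'v::euclidean_space"
  assumes "finite S" "S \<subseteq> I" "card S \<ge> DIM('v) + 2"
  shows "\<not> shatters (affine_sublevels X x I) S"
proof
  assume sh: "shatters (affine_sublevels X x I) S"
  obtain c where c: "(\<Sum>i\<in>S. c i) = 0" "(\<Sum>i\<in>S. c i *\<^sub>R X i) = 0" "\<exists>i\<in>S. c i \<noteq> 0"
    using affine_dependent_family[OF assms(1,3)] by blast
  \<comment> \<open>The coefficients sum to zero without all vanishing. A positive one makes the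
    first sum strictly negative.\<close>
  have ex_pos: "\<exists>i\<in>S. c i > 0"
  proof (rule ccontr)
    assume "\<not> (\<exists>i\<in>S. c i > 0)"
    then have "\<forall>i\<in>S. - c i = 0"
      using c(1) assms(1) by (subst sum_nonneg_eq_0_iff[symmetric]) (auto simp: sum_negf not_less)
    then show False using c(3) by auto
  qed
  have sum_gap: "(\<Sum>i\<in>S. c i * (a \<bullet> X i + b - x i)) = - (\<Sum>i\<in>S. c i * x i)" for a b
  proof -
    have "(\<Sum>i\<in>S. c i * (a \<bullet> X i + b - x i))
        = a \<bullet> (\<Sum>i\<in>S. c i *\<^sub>R X i) + (\<Sum>i\<in>S. c i) * b - (\<Sum>i\<in>S. c i * x i)"
      by (simp add: inner_sum_right sum_distrib_right algebra_simps sum.distrib sum_subtractf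
          flip: sum_distrib_left)
    then show ?thesis using c by simp
  qed
  have cut: "\<exists>a b. \<forall>i\<in>S. a \<bullet> X i + b < x i \<longleftrightarrow> i \<in> J" if J: "J \<subseteq> S" for J
  proof -
    obtain A where "A \<in> affine_sublevels X x I" "A \<inter> S = J"
      using shattersD[OF sh J] by blast
    then show ?thesis using assms(2) by (fastforce simp: affine_sublevels_def)
  qed
  obtain a b where ab: "\<forall>i\<in>S. a \<bullet> X i + b < x i \<longleftrightarrow> i \<in> {i \<in> S. c i > 0}"
    using cut[of "{i \<in> S. c i > 0}"] by auto
  have "(\<Sum>i\<in>S. c i * (a \<bullet> X i + b - x i)) < (\<Sum>i\<in>S. 0)"
  proof (rule sum_strict_mono_ex1[OF assms(1)])
    show "\<forall>i\<in>S. c i * (a \<bullet> X i + b - x i) \<le> 0"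
      using ab by (fastforce simp: mult_le_0_iff not_less)
    show "\<exists>i\<in>S. c i * (a \<bullet> X i + b - x i) < 0"
      using ab ex_pos by (fastforce simp: mult_less_0_iff)
  qed
  then have pos: "(\<Sum>i\<in>S. c i * x i) > 0" by (simp add: sum_gap)
  obtain a' b' where ab': "\<forall>i\<in>S. a' \<bullet> X i + b' < x i \<longleftrightarrow> i \<in> {i \<in> S. c i < 0}"
    using cut[of "{i \<in> S. c i < 0}"] by auto
  have "(\<Sum>i\<in>S. c i * (a' \<bullet> X i + b' - x i)) \<ge> 0"
    using ab' by (intro sum_nonneg) (fastforce simp: zero_le_mult_iff not_less)
  then show False using pos by (simp add: sum_gap)
qed

section \<open>Solving the counting inequality for the number of indices\<close>

lemma shattered_card_bound:
  fixes m D t :: nat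
  assumes "m \<ge> 1" "D \<ge> 1" "D \<le> t"
    and "2 ^ t \<le> ((exp 1 * real t / real D) ^ D) ^ m"
  shows "real t \<le> 3 * real m * real D * ln (3 * real m)"
proof (rule ccontr)
  define L where "L = ln (3 * real m)"
  define s where "s = real t / real D"
  define s0 where "s0 = 3 * real m * L"
  have "exp 1 \<le> 3 * real m" using exp_le assms(1) by linarith
  then have L: "L \<ge> 1"
    using assms(1) by (simp add: L_def ln_ge_iff)
  then have s0: "s0 > 0" using assms(1) by (simp add: s0_def)
  assume "\<not> ?thesis"
  then have gt: "s > s0"
    using assms(2) by (simp add: s_def s0_def L_def field_simps)
  then have s: "s > 0" using s0 by simp
  have "(2::real) ^ t \<le> ((exp 1 * s) ^ D) ^ m"
    using assms(4) by (simp add: s_def)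
  then have "ln (2 ^ t :: real) \<le> ln (((exp 1 * s) ^ D) ^ m)"
    using s by (subst ln_le_cancel_iff) auto
  then have "real t * ln 2 \<le> real m * (real D * (1 + ln s))"
    using s by (simp add: ln_realpow ln_mult)
  then have "s * ln 2 \<le> real m * (1 + ln s)"
    using assms(2) by (simp add: s_def field_simps)
  \<comment> \<open>The tangent of \<open>ln\<close> at the claimed threshold \<open>s0\<close>
    makes the inequality linear in \<open>s\<close>.\<close>
  also have "ln s \<le> ln s0 + s / s0 - 1"
    using ln_le_minus_one[of "s / s0"] s s0 by (simp add: ln_div)
  also have "ln s0 = L + ln L"
    using assms(1) L by (simp add: s0_def ln_mult L_def)
  also have "ln L \<le> L - 1"
    using L by (intro ln_le_minus_one) simp
  finally have "s * ln 2 \<le> real m * (2 * L - 1 + s / s0)"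
    using assms(1) by (simp add: mult_left_mono algebra_simps)
  also have "\<dots> = real m * (2 * L - 1) + s / (3 * L)"
    using assms(1) L by (simp add: s0_def field_simps)
  finally have "s * (ln 2 - 1 / (3 * L)) \<le> real m * (2 * L - 1)"
    by (simp add: algebra_simps)
  \<comment> \<open>With \<open>ln 2 \<ge> 2 / 3\<close>, the factor 3 in \<open>s0\<close> gives
    equality at \<open>s = s0\<close>. The coefficient of \<open>s\<close> is positive since
    \<open>L \<ge> 1\<close>, so \<open>s > s0\<close> is contradictory.\<close>
  moreover have "s * (ln 2 - 1 / (3 * L)) \<ge> s * (2 / 3 - 1 / (3 * L))"
    using s ln2_ge_two_thirds by (intro mult_left_mono) auto
  moreover have "s * (2 / 3 - 1 / (3 * L)) > s0 * (2 / 3 - 1 / (3 * L))"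
    using gt L by (intro mult_strict_right_mono) (auto simp: field_simps)
  moreover have "s0 * (2 / 3 - 1 / (3 * L)) = real m * (2 * L - 1)"
    using L by (simp add: s0_def field_simps)
  ultimately show False by linarith
qed

section \<open>From max-affine functions to intersections of sublevel sets\<close>

text \<open>A maximum lies below a level iff every piece does, so each subset of \<open>I\<close> is
  the intersection of an \<open>m\<close>-tuple of affine sublevel sets.\<close>

lemma max_affine_patterns:
  fixes X :: "'n::finite \<Rightarrow> real ^ 'd"
  assumes "\<And>i. X i \<in> \<Omega>" "m \<ge> 1"
    and pat: "\<And>J. J \<subseteq> I \<Longrightarrow> \<exists>v\<in>sample_values X (max_affine \<Omega> m).
                (\<forall>i\<in>J. v $ i > x i) \<and> (\<forall>i\<in>I - J. v $ i < x i)"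
  shows "2 ^ card I \<le> card (affine_sublevels X x I) ^ m"
proof -
  let ?F = "affine_sublevels X x I"
  have "?F \<subseteq> Pow I" by (auto simp: affine_sublevels_def)
  then have fin: "finite ?F" by (meson finite finite_subset)
  have "Pow I \<subseteq> (\<lambda>A. \<Inter>k\<in>{1..m}. A k) ` ({1..m} \<rightarrow>\<^sub>E ?F)"
  proof
    fix K assume K: "K \<in> Pow I"
    \<comment> \<open>The intersection describes where \<open>v\<close> is below the levels, so the
      pattern requested above them is the complement of \<open>K\<close>.\<close>
    obtain v where v: "v \<in> sample_values X (max_affine \<Omega> m)"
      "\<forall>i\<in>I - K. v $ i > x i" "\<forall>i\<in>I - (I - K). v $ i < x i"
      using pat[of "I - K"] by auto
    obtain a b where val: "v = (\<chi> i. restrict (\<lambda>x. MAX k\<in>{1..m}. a k \<bullet> x + b k) \<Omega> (X i))"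
      using v(1) by (auto simp: sample_values_def max_affine_def)
    have less_iff: "v $ i < x i \<longleftrightarrow> (\<forall>k\<in>{1..m}. a k \<bullet> X i + b k < x i)" for i
      using assms(1,2) by (simp add: val)
    define A where "A = (\<lambda>k\<in>{1..m}. {i \<in> I. a k \<bullet> X i + b k < x i})"
    have "A \<in> {1..m} \<rightarrow>\<^sub>E ?F" by (auto simp: A_def affine_sublevels_def)
    moreover have "i \<in> (\<Inter>k\<in>{1..m}. A k) \<longleftrightarrow> i \<in> K" for i
    proof -
      have "i \<in> (\<Inter>k\<in>{1..m}. A k) \<longleftrightarrow> i \<in> I \<and> v $ i < x i"
        using assms(2) by (auto simp: A_def less_iff)
      also have "\<dots> \<longleftrightarrow> i \<in> K" using v(2,3) K by force
      finally show ?thesis .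
    qed
    ultimately show "K \<in> (\<lambda>A. \<Inter>k\<in>{1..m}. A k) ` ({1..m} \<rightarrow>\<^sub>E ?F)" by blast
  qed
  then have "card (Pow I) \<le> card ((\<lambda>A. \<Inter>k\<in>{1..m}. A k) ` ({1..m} \<rightarrow>\<^sub>E ?F))"
    using fin by (intro card_mono finite_imageI finite_PiE) auto
  also have "\<dots> \<le> card ({1..m} \<rightarrow>\<^sub>E ?F)"
    using fin by (intro card_image_le finite_PiE) auto
  finally show ?thesis by (simp add: card_Pow card_PiE)
qed

theorem lemma4p9:
  fixes \<Omega> :: "(real ^ 'd) set"
    and X :: "'n::finite \<Rightarrow> real ^ 'd"
    and m :: nat
  assumes "convex_body \<Omega>"
    and "\<And>i. X i \<in> \<Omega>"
    and "m \<ge> 1"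
  shows "real (pdim (sample_values X (max_affine \<Omega> m)))
           \<le> 6 * real m * real CARD('d) * ln (3 * real m)"
proof (rule ccontr)
  let ?V = "sample_values X (max_affine \<Omega> m)"
  define t where "t = pdim ?V"
  \<comment> \<open>Sublevel sets fail to shatter from size \<open>CARD('d) + 2\<close>, which is
    \<open>D + 1\<close>.\<close>
  define D where "D = CARD('d) + 1"
  assume "\<not> ?thesis"
  then have gt: "real t > 6 * real m * real CARD('d) * ln (3 * real m)"
    by (simp add: t_def)
  have d: "CARD('d) \<ge> 1" by (simp add: Suc_leI)
  have "exp 1 \<le> 3 * real m" using exp_le assms(3) by linarith
  then have L: "ln (3 * real m) \<ge> 1"
    using assms(3) by (simp add: ln_ge_iff)
  \<comment> \<open>Absorbing \<open>d + 1\<close> into \<open>2 * d\<close> turns the constant 3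
    into 6.\<close>
  have "2 * real CARD('d) \<ge> real D"
    using d by (simp add: D_def)
  then have "3 * real m * real D * ln (3 * real m) \<le> 3 * real m * (2 * real CARD('d)) * ln (3 * real m)"
    using L by (intro mult_right_mono mult_left_mono) auto
  also have "\<dots> = 6 * real m * real CARD('d) * ln (3 * real m)"
    by simp
  finally have gt': "real t > 3 * real m * real D * ln (3 * real m)"
    using gt by linarith
  \<comment> \<open>This yields \<open>D \<le> t\<close>, required by the binomial estimate; it also
    gives \<open>t \<ge> 1\<close>, so \<open>t - 1\<close> is a genuine predecessor.\<close>
  have "1 * 1 \<le> (3 * real m) * ln (3 * real m)"
    using L assms(3) by (intro mult_mono) auto
  then have "real D * 1 \<le> real D * ((3 * real m) * ln (3 * real m))"
    by (intro mult_left_mono) auto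
  then have "D \<le> t" using gt' by (simp add: mult_ac)
  \<comment> \<open>By minimality \<open>t - 1\<close> is not admissible, and its failure produces a
    shattered index set of size exactly \<open>t\<close>.\<close>
  then have "\<not> pdim_at_most ?V (t - 1)"
    unfolding t_def pdim_def by (intro not_less_Least) (simp add: D_def)
  then obtain I x where I: "card I = t"
    and pat: "\<And>J. J \<subseteq> I \<Longrightarrow> \<exists>v\<in>?V. (\<forall>i\<in>J. v $ i > x i) \<and> (\<forall>i\<in>I - J. v $ i < x i)"
    using \<open>D \<le> t\<close> by (auto simp: pdim_at_most_def D_def)
  let ?F = "affine_sublevels X x I"
  have "real (card ?F) \<le> (exp 1 * real (card I) / real D) ^ D"
  proof (rule Sauer_Shelah)
    show "?F \<subseteq> Pow I" by (auto simp: affine_sublevels_def)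
    show "\<not> shatters ?F S" if "S \<subseteq> I" "card S = D + 1" for S
      using that by (intro affine_sublevels_not_shatters) (auto simp: D_def)
  qed (use \<open>D \<le> t\<close> I in \<open>auto simp: D_def\<close>)
  then have "real (card ?F) ^ m \<le> ((exp 1 * real t / real D) ^ D) ^ m"
    unfolding I by (intro power_mono) auto
  moreover have "2 ^ t \<le> real (card ?F) ^ m"
    using max_affine_patterns[OF assms(2,3) pat] unfolding I
    by (metis of_nat_le_iff of_nat_numeral of_nat_power)
  ultimately have "2 ^ t \<le> ((exp 1 * real t / real D) ^ D) ^ m"
    by linarith
  then show False
    using shattered_card_bound[of m D t] assms(3) \<open>D \<le> t\<close> gt' by (simp add: D_def)
qed

end
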